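(* Consider a stochastic computation graph with a finite set $\mathcal{X}$ of random variables, a directed acyclic graph $\mathcal{G}_{\mathcal{X}}$ on $\mathcal{X}$, conditional distributions $X \sim p(\cdot \mid Pa_X; \theta_X)$ for $X \in \mathcal{X}$, each random variable being associated with its own distribution parameter $\theta_X$, and a single cost function $f$ defined on a subset $\mathcal{Z} \subseteq \mathcal{X}$ of the random variables. Let $J = \mathbb{E}[f(\mathcal{Z})]$ be the expected total cost, the expectation being over the joint distribution of $\mathcal{X}$. For each $X \in \mathcal{X}$ define the Q-function $$Q_X\big(Fr_{An_X \cup \{X\}}\big) := \mathbb{E}_{\mathcal{Z} \mid Fr_{An_X \cup \{X\}}}\big[f(\mathcal{Z})\big],$$ the conditional expectation of the cost given the variables in the frontier $Fr_{An_X\cup\{X\}}$ of $An_X \cup \{X\}$. Then for every $X \in \mathcal{X}$, $$\nabla_{\theta_X} J = \mathbb{E}_{An_X, X}\Big[ \big(\nabla_{\theta_X} \log p(X \mid Pa_X; \theta_X)\big) \cdot Q_X\big(Fr_{An_X \cup \{X\}}\big) \Big].$$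
   Context: The joint distribution of $\mathcal{X}$ is the one given by ancestral sampling along $\mathcal{G}_{\mathcal{X}}$, i.e. it has density or mass function $\prod_{X \in \mathcal{X}} p(x \mid Pa_X; \theta_X)$. Random variables may be discrete or continuous. The parameter $\theta_X$ enters only the conditional distribution of $X$; in particular $f$ and the conditional distributions of the other variables do not depend on $\theta_X$. $Pa_X$ is the set of parents of $X$ in $\mathcal{G}_{\mathcal{X}}$ and $An_X$ is the set of (strict) ancestors of $X$ in $\mathcal{G}_{\mathcal{X}}$. $\mathbb{E}_{An_X, X}$ denotes expectation over the joint distribution of the variables in $An_X \cup \{X\}$. Frontier: regard the cost $f$ as an additional terminal node with an edge from each variable in $\mathcal{Z}$. For a set $V \subseteq \mathcal{X}$, the frontier $Fr_V \subseteq V$ is the set of those variables in $V$ from which the cost is reachable through random variables not in $V$, i.e. those $v \in V$ for which there is a directed path from $v$ to the cost node all of whose intermediate nodes (if any) lie in $\mathcal{X} \setminus V$. Implicit regularity conventions: the conditional densities/mass functions are positive and differentiable in their parameters wherever $\nabla_{\theta_X}\log p$ is written, all expectations written exist, and differentiation in $\theta_X$ may be exchanged with the sums/integrals defining $J$. *)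

theory Defs
  imports "HOL-Probability.Probability"
begin

text \<open>
  A node \<open>v\<close> takes values in \<open>space (base G v)\<close>. The measure \<open>base G v\<close> is the sigma-finite
  reference measure for its densities: counting measure on a countable set for a discrete variable,
  Lebesgue measure for a continuous one; the two kinds may be mixed in one graph.
  \<open>cond_density G v t y x\<close> is the density at \<open>x\<close> of the variable \<open>v\<close>, given its parameter \<open>t\<close>
  and the assignment \<open>y\<close> of values to its parents. All nodes share one parameter type, but a node
  with fewer parameters is covered: it ignores the remaining coordinates, and \<open>params G v\<close> is a
  cylinder. The cost reads an assignment of values to the nodes in \<open>cost_args G\<close> only.
\<close>

record ('n, 'a, 'p) stoch_graph =
  nodes :: "'n set"
  edges :: "('n \<times> 'n) set"
  base :: "'n \<Rightarrow> 'a measure"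
  params :: "'n \<Rightarrow> 'p set"
  cond_density :: "'n \<Rightarrow> 'p \<Rightarrow> ('n \<Rightarrow> 'a) \<Rightarrow> 'a \<Rightarrow> real"
  cost_args :: "'n set"
  cost :: "('n \<Rightarrow> 'a) \<Rightarrow> real"

definition parents :: "('n, 'a, 'p) stoch_graph \<Rightarrow> 'n \<Rightarrow> 'n set" where
  "parents G v = {u. (u, v) \<in> edges G}"

definition ancestors :: "('n, 'a, 'p) stoch_graph \<Rightarrow> 'n \<Rightarrow> 'n set" where
  "ancestors G v = {u. (u, v) \<in> (edges G)\<^sup>+}"

definition stoch_comp_graph :: "('n, 'a, 'p::euclidean_space) stoch_graph \<Rightarrow> bool" where
  "stoch_comp_graph G \<longleftrightarrow>
     finite (nodes G) \<and> edges G \<subseteq> nodes G \<times> nodes G \<and> acyclic (edges G) \<and>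
     (\<forall>v\<in>nodes G. sigma_finite_measure (base G v)) \<and>
     (\<forall>v\<in>nodes G. open (params G v)) \<and>
     (\<forall>v\<in>nodes G. \<forall>t\<in>params G v.
        (\<lambda>(y, x). cond_density G v t y x)
          \<in> borel_measurable (PiM (parents G v) (base G) \<Otimes>\<^sub>M base G v) \<and>
        (\<forall>y\<in>space (PiM (parents G v) (base G)).
           (\<forall>x\<in>space (base G v). 0 \<le> cond_density G v t y x) \<and>
           (\<integral>\<^sup>+x. ennreal (cond_density G v t y x) \<partial>base G v) = 1)) \<and>
     cost_args G \<subseteq> nodes G \<and>
     cost G \<in> borel_measurable (PiM (cost_args G) (base G))"

definition valid_params :: "('n, 'a, 'p) stoch_graph \<Rightarrow> ('n \<Rightarrow> 'p) \<Rightarrow> bool" where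
  "valid_params G \<theta> \<longleftrightarrow> (\<forall>v\<in>nodes G. \<theta> v \<in> params G v)"

definition joint_density :: "('n, 'a, 'p) stoch_graph \<Rightarrow> ('n \<Rightarrow> 'p) \<Rightarrow> ('n \<Rightarrow> 'a) \<Rightarrow> real" where
  "joint_density G \<theta> x = (\<Prod>v\<in>nodes G. cond_density G v (\<theta> v) (restrict x (parents G v)) (x v))"

definition joint :: "('n, 'a, 'p) stoch_graph \<Rightarrow> ('n \<Rightarrow> 'p) \<Rightarrow> ('n \<Rightarrow> 'a) measure" where
  "joint G \<theta> = density (PiM (nodes G) (base G)) (\<lambda>x. ennreal (joint_density G \<theta> x))"

definition marginal ::
    "('n, 'a, 'p) stoch_graph \<Rightarrow> ('n \<Rightarrow> 'p) \<Rightarrow> 'n set \<Rightarrow> ('n \<Rightarrow> 'a) measure" where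
  "marginal G \<theta> S = distr (joint G \<theta>) (PiM S (base G)) (\<lambda>x. restrict x S)"

definition total_cost :: "('n, 'a, 'p) stoch_graph \<Rightarrow> ('n \<Rightarrow> 'a) \<Rightarrow> real" where
  "total_cost G x = cost G (restrict x (cost_args G))"

definition expected_cost :: "('n, 'a, 'p) stoch_graph \<Rightarrow> ('n \<Rightarrow> 'p) \<Rightarrow> real" where
  "expected_cost G \<theta> = (\<integral>x. total_cost G x \<partial>joint G \<theta>)"

text \<open>In the graph extended by the cost, the random variables are \<open>Some v\<close>, the cost is \<open>None\<close>.\<close>

definition cost_edges :: "('n, 'a, 'p) stoch_graph \<Rightarrow> ('n option \<times> 'n option) set" where
  "cost_edges G = {(Some u, Some v) | u v. (u, v) \<in> edges G} \<union> {(Some z, None) | z. z \<in> cost_args G}"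

definition cost_frontier :: "('n, 'a, 'p) stoch_graph \<Rightarrow> 'n set \<Rightarrow> 'n set" where
  "cost_frontier G S =
     {v\<in>S. \<exists>us. set us \<subseteq> Some ` (nodes G - S) \<and>
        successively (\<lambda>a b. (a, b) \<in> cost_edges G) (Some v # us @ [None])}"

text \<open>
  A conditional expectation is determined only almost surely: \<open>is_Q_function G \<theta> v q\<close> says that
  \<open>q\<close> is a version of it, written as a function of the frontier variables.
\<close>

definition is_Q_function ::
    "('n, 'a, 'p) stoch_graph \<Rightarrow> ('n \<Rightarrow> 'p) \<Rightarrow> 'n \<Rightarrow> (('n \<Rightarrow> 'a) \<Rightarrow> real) \<Rightarrow> bool" where
  "is_Q_function G \<theta> v q \<longleftrightarrow>
     (let Fr = cost_frontier G (ancestors G v \<union> {v});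
          \<F> = vimage_algebra (space (joint G \<theta>)) (\<lambda>x. restrict x Fr) (PiM Fr (base G))
      in q \<in> borel_measurable (PiM Fr (base G)) \<and>
         (AE x in joint G \<theta>.
            q (restrict x Fr) = real_cond_exp (joint G \<theta>) \<F> (total_cost G) x))"

lemma factor_through_vimage_algebra_ennreal:
  fixes h :: "'b \<Rightarrow> ennreal"
  assumes "h \<in> borel_measurable (vimage_algebra X g N)" "g \<in> X \<rightarrow> space N"
  shows "\<exists>q\<in>borel_measurable N. \<forall>x\<in>X. h x = q (g x)"
  using assms(1)
proof (induction rule: borel_measurable_induct)
  case (cong f f')
  then show ?case by simp
next
  case (set A)
  then obtain B where B: "B \<in> sets N" "A = g -` B \<inter> X"
    using assms(2) by (auto simp: sets_vimage_algebra2)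
  then show ?case
    by (intro bexI[of _ "indicator B"]) (auto simp: indicator_def)
next
  case (mult u c)
  then obtain q where "q \<in> borel_measurable N" "\<forall>x\<in>X. u x = q (g x)"
    by blast
  then show ?case
    by (intro bexI[of _ "\<lambda>y. c * q y"]) auto
next
  case (add u v)
  then obtain q r where "q \<in> borel_measurable N" "\<forall>x\<in>X. u x = q (g x)"
    "r \<in> borel_measurable N" "\<forall>x\<in>X. v x = r (g x)"
    by blast
  then show ?case
    by (intro bexI[of _ "\<lambda>y. r y + q y"]) auto
next
  case (seq U)
  have "\<forall>i. \<exists>q. q \<in> borel_measurable N \<and> (\<forall>x\<in>X. U i x = q (g x))"
    using seq.IH by blast
  then obtain q where q: "\<And>i. q i \<in> borel_measurable N" "\<And>i x. x \<in> X \<Longrightarrow> U i x = q i (g x)"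
    by metis
  have "(\<lambda>y. SUP i. q i y) \<in> borel_measurable N"
    using q(1) by (intro borel_measurable_SUP) simp_all
  moreover have "\<forall>x\<in>X. Sup (range U) x = (SUP i. q i (g x))"
    by (intro ballI) (simp only: SUP_apply q(2))
  ultimately show ?case
    by (intro bexI[of _ "\<lambda>y. SUP i. q i y"])
qed

lemma Q_function_exists:
  assumes "stoch_comp_graph G" "v \<in> nodes G"
  shows "\<exists>q. is_Q_function G \<theta> v q"
proof -
  define Fr where "Fr = cost_frontier G (ancestors G v \<union> {v})"
  define X where "X = space (joint G \<theta>)"
  define F where "F = vimage_algebra X (\<lambda>x. restrict x Fr) (PiM Fr (base G))"
  define h where "h = real_cond_exp (joint G \<theta>) F (total_cost G)"
  have "(edges G)\<^sup>+ \<subseteq> nodes G \<times> nodes G"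
    using assms(1) by (intro trancl_subset_Sigma) (simp add: stoch_comp_graph_def)
  then have "Fr \<subseteq> nodes G"
    using assms(2) by (auto simp: Fr_def cost_frontier_def ancestors_def)
  then have sub: "(\<lambda>x. restrict x Fr) \<in> X \<rightarrow> space (PiM Fr (base G))"
    by (auto simp: X_def joint_def space_PiM)
  have [measurable]: "h \<in> borel_measurable F"
    unfolding h_def by (rule borel_measurable_cond_exp)
  have m: "(\<lambda>x. ennreal (h x)) \<in> borel_measurable F" "(\<lambda>x. ennreal (- h x)) \<in> borel_measurable F"
    by measurable
  obtain q r where [measurable]: "q \<in> borel_measurable (PiM Fr (base G))"
      "r \<in> borel_measurable (PiM Fr (base G))"
    and qr: "\<forall>x\<in>X. ennreal (h x) = q (restrict x Fr)" "\<forall>x\<in>X. ennreal (- h x) = r (restrict x Fr)"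
    using factor_through_vimage_algebra_ennreal[OF m(1)[unfolded F_def] sub]
      factor_through_vimage_algebra_ennreal[OF m(2)[unfolded F_def] sub] by blast
  define k where "k y = enn2real (q y) - enn2real (r y)" for y
  have "k (restrict x Fr) = h x" if "x \<in> X" for x
  proof -
    have "k (restrict x Fr) = enn2real (ennreal (h x)) - enn2real (ennreal (- h x))"
      using qr that by (simp add: k_def)
    then show ?thesis
      by (cases "0 \<le> h x") (simp_all add: ennreal_neg)
  qed
  then have "AE x in joint G \<theta>. k (restrict x Fr) = h x"
    unfolding X_def by (intro AE_I2)
  moreover have "k \<in> borel_measurable (PiM Fr (base G))"
    unfolding k_def by measurable
  ultimately show ?thesis
    by (auto simp: is_Q_function_def Let_def Fr_def X_def F_def h_def)
qed

text \<open>The gradient of a real function at a point where it is differentiable.\<close>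

definition gradient :: "('p::euclidean_space \<Rightarrow> real) \<Rightarrow> 'p \<Rightarrow> 'p" where
  "gradient g t = (THE D. GDERIV g t :> D)"

end

theory Submission
  imports Defs
begin

text \<open>
  Differentiating under the integral sign gives the gradient of the expected cost as
  \<open>\<integral> c p s\<close> with \<open>c\<close> the cost, \<open>p\<close> the joint density and \<open>s\<close> the score of \<open>X\<close>. Let \<open>S\<close> consist of \<open>X\<close>
  and its ancestors. The score is measurable with respect to \<open>S\<close>, so \<open>c\<close> may be replaced by its
  conditional expectation given \<open>S\<close>, and it remains to see that this depends on the frontier \<open>F\<close>
  only. Let \<open>D\<close> be the set of nodes outside \<open>S\<close> from which the cost is reachable outside \<open>S\<close>. All
  parents of \<open>D\<close> and all arguments of the cost lie in \<open>F \<union> D\<close>, and \<open>S \<union> D\<close> is closed under parents.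
  So the other nodes integrate out, and integrating the cost against the kernels of \<open>D\<close> gives a
  function of the frontier variables which is a version of both conditional expectations.
\<close>

section \<open>Bayesian networks: product densities and their marginals\<close>

lemma measurable_restrict_vimage_algebra:
  assumes "F \<subseteq> T" "T \<subseteq> N"
  shows "(\<lambda>x. restrict x F) \<in> vimage_algebra (space (PiM N M)) (\<lambda>x. restrict x T) (PiM T M) \<rightarrow>\<^sub>M PiM F M"
proof -
  have "(\<lambda>x. restrict x T) \<in> space (PiM N M) \<rightarrow> space (PiM T M)"
    using assms by (auto simp: space_PiM PiE_iff)
  from measurable_compose[OF measurable_vimage_algebra1[OF this] measurable_restrict_subset[OF assms(1)]]
  show ?thesis
    using assms by (simp add: Int_absorb1)
qed

lemma merge_space_PiM:
  "y \<in> space (PiM I M) \<Longrightarrow> z \<in> space (PiM J M) \<Longrightarrow> merge I J (y, z) \<in> space (PiM (I \<union> J) M)"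
  using measurable_space[OF measurable_merge, of "(y, z)" I M J] by (simp add: space_pair_measure)

text \<open>All parameters are frozen here, and the kernels take values in \<open>ennreal\<close>,
  so that products of kernels can be integrated iteratively without integrability conditions. The
  parent map is tied to the relation \<open>E\<close> because integrating out nodes one by one rests
  on acyclicity.\<close>

locale bayes_net = product_sigma_finite M
  for M :: "'n \<Rightarrow> 'a measure" +
  fixes N :: "'n set" and E :: "('n \<times> 'n) set" and pa :: "'n \<Rightarrow> 'n set"
    and k :: "'n \<Rightarrow> ('n \<Rightarrow> 'a) \<Rightarrow> 'a \<Rightarrow> ennreal"
  assumes finite_N: "finite N" and E_sub: "E \<subseteq> N \<times> N" and acyclic_E: "acyclic E"
    and pa_def: "pa v = {u. (u, v) \<in> E}"
    and k_meas: "v \<in> N \<Longrightarrow> (\<lambda>(y, x). k v y x) \<in> borel_measurable (PiM (pa v) M \<Otimes>\<^sub>M M v)"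
    and k_one: "v \<in> N \<Longrightarrow> y \<in> space (PiM (pa v) M) \<Longrightarrow> (\<integral>\<^sup>+x. k v y x \<partial>M v) = 1"
begin

text \<open>Arbitrary \<open>U\<close> is allowed because the joint density \<open>weight N\<close>
  gets split into factors belonging to disjoint sets of nodes.\<close>

definition weight :: "'n set \<Rightarrow> ('n \<Rightarrow> 'a) \<Rightarrow> ennreal" where
  "weight U x = (\<Prod>v\<in>U. k v (restrict x (pa v)) (x v))"

abbreviation J :: "('n \<Rightarrow> 'a) measure" where
  "J \<equiv> density (PiM N M) (weight N)"

lemma finite_sub: "U \<subseteq> N \<Longrightarrow> finite U"
  using finite_N finite_subset by blast

lemma pa_N: "pa v \<subseteq> N"
  using E_sub by (auto simp: pa_def)

lemma k_measurable:
  assumes "v \<in> N" "v \<in> T" "pa v \<subseteq> T"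
  shows "(\<lambda>x. k v (restrict x (pa v)) (x v)) \<in> borel_measurable (PiM T M)"
proof -
  have "(\<lambda>x. (restrict x (pa v), x v)) \<in> PiM T M \<rightarrow>\<^sub>M PiM (pa v) M \<Otimes>\<^sub>M M v"
    using assms by (intro measurable_Pair measurable_restrict_subset measurable_component_singleton)
  from measurable_compose[OF this k_meas[OF assms(1)]] show ?thesis by simp
qed

lemma weight_measurable:
  assumes "U \<subseteq> N" "U \<subseteq> T" "\<And>v. v \<in> U \<Longrightarrow> pa v \<subseteq> T"
  shows "weight U \<in> borel_measurable (PiM T M)"
proof -
  have "(\<lambda>x. k v (restrict x (pa v)) (x v)) \<in> borel_measurable (PiM T M)" if "v \<in> U" for v
    using that assms by (intro k_measurable) auto
  then show ?thesis
    unfolding weight_def[abs_def] by (intro borel_measurable_prod_ennreal)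
qed

lemma weight_cong:
  assumes "\<And>v i. v \<in> U \<Longrightarrow> i = v \<or> i \<in> pa v \<Longrightarrow> x i = y i"
  shows "weight U x = weight U y"
  unfolding weight_def
proof (rule prod.cong[OF refl])
  fix v assume "v \<in> U"
  then have "restrict x (pa v) = restrict y (pa v)" "x v = y v"
    using assms by (auto simp: fun_eq_iff restrict_def)
  then show "k v (restrict x (pa v)) (x v) = k v (restrict y (pa v)) (y v)" by simp
qed

lemma weight_union: "U \<subseteq> N \<Longrightarrow> V \<subseteq> N \<Longrightarrow> U \<inter> V = {} \<Longrightarrow> weight (U \<union> V) x = weight U x * weight V x"
  unfolding weight_def by (intro prod.union_disjoint finite_sub)

text \<open>Acyclicity gives a node of \<open>U\<close> that is a parent of no node of
  \<open>U\<close>. Its variable occurs in its own kernel only, so the innermost integral over it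
  contributes the factor 1 by \<open>k_one\<close>, and the same integral for a smaller set remains.
  The fixed values \<open>y\<close> on \<open>I\<close> supply the parents outside
  \<open>U\<close>.\<close>

lemma nn_integral_weight:
  assumes "U \<subseteq> N" "I \<inter> U = {}" "\<And>v. v \<in> U \<Longrightarrow> pa v \<subseteq> I \<union> U" "y \<in> space (PiM I M)"
  shows "(\<integral>\<^sup>+u. weight U (merge I U (y, u)) \<partial>PiM U M) = 1"
  using finite_sub[OF assms(1)] assms
proof (induction U rule: finite_psubset_induct)
  case (psubset U)
  show ?case
  proof (cases "U = {}")
    case True
    then show ?thesis by (simp add: weight_def PiM_empty nn_integral_count_space_finite)
  next
    case False
    \<comment> \<open>A minimal element of \<open>U\<close> for the converse of \<open>E\<close> has
      no edge into \<open>U\<close>.\<close>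
    have "finite E"
      using E_sub finite_N finite_subset by blast
    then have "wf (E\<inverse>)"
      using acyclic_E by (rule finite_acyclic_wf_converse)
    with False obtain v where v: "v \<in> U" and "\<And>u. (u, v) \<in> E\<inverse> \<Longrightarrow> u \<notin> U"
      by (metis wfE_min ex_in_conv)
    then have sink: "v \<notin> pa u" if "u \<in> U" for u
      using that by (auto simp: pa_def)
    define U' where "U' = U - {v}"
    have U: "U = insert v U'" "v \<notin> U'" "U' \<subset> U" "finite U'"
      using v psubset.hyps by (auto simp: U'_def)
    have pa: "pa u \<subseteq> I \<union> U'" if "u \<in> U" for u
      using psubset.prems(3)[OF that] sink[OF that] U(1) by auto
    have vI: "v \<notin> I" and vN: "v \<in> N"
      using v psubset.prems by auto
    have IU: "I \<union> U = insert v (I \<union> U')" using U by auto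
    have "weight U \<in> borel_measurable (PiM (I \<union> U) M)"
      using psubset.prems by (intro weight_measurable) auto
    moreover have "(\<lambda>u. merge I U (y, u)) \<in> PiM U M \<rightarrow>\<^sub>M PiM (I \<union> U) M"
      using psubset.prems(4) by (intro measurable_compose[OF measurable_Pair1' measurable_merge])
    ultimately have "(\<lambda>u. weight U (merge I U (y, u))) \<in> borel_measurable (PiM (insert v U') M)"
      using U(1) by (metis measurable_compose)
    then have "(\<integral>\<^sup>+u. weight U (merge I U (y, u)) \<partial>PiM U M)
        = (\<integral>\<^sup>+u. (\<integral>\<^sup>+a. weight U (merge I U (y, u(v := a))) \<partial>M v) \<partial>PiM U' M)"
      unfolding U(1) by (rule product_nn_integral_insert[OF U(4,2)])
    also have "\<dots> = (\<integral>\<^sup>+u. weight U' (merge I U' (y, u)) \<partial>PiM U' M)"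
    proof (rule nn_integral_cong)
      fix u assume u: "u \<in> space (PiM U' M)"
      define m where "m = merge I U' (y, u)"
      have eq: "restrict (merge I U (y, u(v := a))) T = restrict m T" if "T \<subseteq> I \<union> U'" for a T
        using that U vI by (auto simp: fun_eq_iff merge_def restrict_def m_def)
      \<comment> \<open>The coordinate \<open>v\<close> lies neither in \<open>pa v\<close> nor
        among those read by the kernels of \<open>U'\<close>, so \<open>a\<close> enters through one
        factor only.\<close>
      have "weight U (merge I U (y, u(v := a))) = k v (restrict m (pa v)) a * weight U' m" for a
      proof -
        have "weight U (merge I U (y, u(v := a))) = k v (restrict m (pa v)) a * weight U' (merge I U (y, u(v := a)))"
          unfolding weight_def U(1) prod.insert[OF U(4,2)]
          using eq[OF pa[OF v]] vI U by (simp add: merge_def)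
        also have "weight U' (merge I U (y, u(v := a))) = weight U' m"
        proof (rule weight_cong)
          fix z i assume "z \<in> U'" "i = z \<or> i \<in> pa z"
          then have "i \<in> I \<union> U'" using pa U by auto
          then show "merge I U (y, u(v := a)) i = m i"
            using U vI by (auto simp: merge_def m_def)
        qed
        finally show ?thesis .
      qed
      moreover have m: "restrict m (pa v) \<in> space (PiM (pa v) M)"
        using measurable_space[OF measurable_restrict_subset[OF pa[OF v]]]
          merge_space_PiM[OF psubset.prems(4) u] by (auto simp: m_def)
      moreover have "k v (restrict m (pa v)) \<in> borel_measurable (M v)"
        using measurable_compose[OF measurable_Pair1'[OF m] k_meas[OF vN]] by simp
      ultimately show "(\<integral>\<^sup>+a. weight U (merge I U (y, u(v := a))) \<partial>M v) = weight U' (merge I U' (y, u))"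
        using k_one[OF vN m] by (simp add: nn_integral_multc m_def)
    qed
    also have "\<dots> = 1"
      using psubset.prems U pa by (intro psubset.IH) auto
    finally show ?thesis .
  qed
qed

text \<open>With the values on \<open>T\<close> fixed, the kernels of the remaining nodes integrate
  to 1 by \<open>nn_integral_weight\<close>. Since \<open>T\<close> is closed under parents,
  \<open>weight T\<close> does not see the integrated variables, so it is the density of the
  marginal on \<open>T\<close>.\<close>

lemma marginal_density:
  assumes T: "T \<subseteq> N" "\<And>v. v \<in> T \<Longrightarrow> pa v \<subseteq> T" and g: "g \<in> borel_measurable (PiM T M)"
  shows "(\<integral>\<^sup>+x. weight N x * g (restrict x T) \<partial>PiM N M) = (\<integral>\<^sup>+y. weight T y * g y \<partial>PiM T M)"
proof -
  define U where "U = N - T"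
  have N: "N = T \<union> U" "T \<inter> U = {}" "U \<subseteq> N" and fin: "finite T" "finite U"
    using T finite_sub by (auto simp: U_def)
  have wU: "weight U \<in> borel_measurable (PiM (T \<union> U) M)"
    using N pa_N by (intro weight_measurable) auto
  have "weight N \<in> borel_measurable (PiM (T \<union> U) M)"
    using N pa_N by (intro weight_measurable) auto
  moreover have "(\<lambda>x. g (restrict x T)) \<in> borel_measurable (PiM (T \<union> U) M)"
    by (rule measurable_compose[OF measurable_restrict_subset g]) auto
  ultimately have "(\<lambda>x. weight N x * g (restrict x T)) \<in> borel_measurable (PiM (T \<union> U) M)"
    by measurable
  then have "(\<integral>\<^sup>+x. weight N x * g (restrict x T) \<partial>PiM (T \<union> U) M)
    = (\<integral>\<^sup>+y. (\<integral>\<^sup>+u. weight N (merge T U (y, u)) * g (restrict (merge T U (y, u)) T) \<partial>PiM U M) \<partial>PiM T M)"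
    by (rule product_nn_integral_fold[OF N(2) fin])
  also have "\<dots> = (\<integral>\<^sup>+y. weight T y * g y \<partial>PiM T M)"
  proof (rule nn_integral_cong)
    fix y assume y: "y \<in> space (PiM T M)"
    have "restrict (merge T U (y, u)) T = y" for u
      using y by (auto simp: fun_eq_iff merge_def space_PiM PiE_iff extensional_def)
    moreover have "weight T (merge T U (y, u)) = weight T y" for u
      using T(2) by (intro weight_cong) (auto simp: merge_def)
    ultimately have "(\<integral>\<^sup>+u. weight N (merge T U (y, u)) * g (restrict (merge T U (y, u)) T) \<partial>PiM U M)
      = (\<integral>\<^sup>+u. (weight T y * g y) * weight U (merge T U (y, u)) \<partial>PiM U M)"
      using weight_union[OF T(1) N(3,2)] N(1) by (simp add: mult_ac)
    also have "(\<lambda>u. weight U (merge T U (y, u))) \<in> borel_measurable (PiM U M)"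
      using y by (intro measurable_compose[OF _ wU] measurable_compose[OF measurable_Pair1' measurable_merge])
    then have "(\<integral>\<^sup>+u. (weight T y * g y) * weight U (merge T U (y, u)) \<partial>PiM U M) = weight T y * g y"
      using nn_integral_weight[OF N(3,2) _ y] pa_N N(1) by (simp add: nn_integral_cmult)
    finally show "(\<integral>\<^sup>+u. weight N (merge T U (y, u)) * g (restrict (merge T U (y, u)) T) \<partial>PiM U M)
      = weight T y * g y" .
  qed
  finally show ?thesis using N(1) by simp
qed

section \<open>The joint law and its conditional expectations\<close>

lemma weight_N_measurable [measurable]: "weight N \<in> borel_measurable (PiM N M)"
  using pa_N by (intro weight_measurable) auto

lemma prob_space_J: "prob_space J"
proof
  \<comment> \<open>The empty set is closed under parents and its weight is the empty product, so
    its marginal formula computes the total mass.\<close>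
  have "weight {} = (\<lambda>_. 1)" by (simp add: weight_def fun_eq_iff)
  then have "(\<integral>\<^sup>+x. weight N x * 1 \<partial>PiM N M) = 1"
    using marginal_density[of "{}" "\<lambda>_. 1"] by (simp add: PiM_empty nn_integral_count_space_finite)
  then show "emeasure J (space J) = 1"
    by (simp add: emeasure_density cong: nn_integral_cong)
qed

text \<open>An explicit candidate for a conditional expectation: the values on \<open>F\<close> are
  held fixed and the kernels of \<open>D\<close> are integrated. It is of interest when all parents
  of \<open>D\<close> lie in \<open>F \<union> D\<close>.\<close>

definition conditional :: "'n set \<Rightarrow> 'n set \<Rightarrow> (('n \<Rightarrow> 'a) \<Rightarrow> ennreal) \<Rightarrow> ('n \<Rightarrow> 'a) \<Rightarrow> ennreal" where
  "conditional F D \<phi> y = (\<integral>\<^sup>+z. weight D (merge F D (y, z)) * \<phi> (merge F D (y, z)) \<partial>PiM D M)"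

lemma conditional_measurable:
  assumes "D \<subseteq> N" "\<And>v. v \<in> D \<Longrightarrow> pa v \<subseteq> F \<union> D" "\<phi> \<in> borel_measurable (PiM (F \<union> D) M)"
  shows "conditional F D \<phi> \<in> borel_measurable (PiM F M)"
proof -
  interpret D: finite_product_sigma_finite M D
    by standard (rule finite_sub[OF assms(1)])
  have "weight D \<in> borel_measurable (PiM (F \<union> D) M)"
    using assms by (intro weight_measurable) auto
  then have "(\<lambda>x. weight D x * \<phi> x) \<in> borel_measurable (PiM (F \<union> D) M)"
    using assms(3) by measurable
  from measurable_compose[OF measurable_merge this]
  have "(\<lambda>p. weight D (merge F D p) * \<phi> (merge F D p)) \<in> borel_measurable (PiM F M \<Otimes>\<^sub>M PiM D M)" .
  from D.borel_measurable_nn_integral_fst[OF this]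
  show ?thesis unfolding conditional_def .
qed

text \<open>Since \<open>F \<subseteq> S\<close>, the set \<open>S \<union> D\<close> is closed
  under parents, so all other nodes integrate out. On \<open>S \<union> D\<close> the weight factors
  into \<open>weight S\<close> and \<open>weight D\<close>, and both \<open>weight D\<close> and
  \<open>\<phi>\<close> see the values on \<open>S\<close> through \<open>F\<close> only; the inner
  integral over \<open>D\<close> is then \<open>conditional F D \<phi>\<close>. The function
  \<open>\<psi>\<close> serves as test function for conditioning on \<open>S\<close>.\<close>

lemma nn_integral_conditional:
  assumes S: "S \<subseteq> N" "\<And>v. v \<in> S \<Longrightarrow> pa v \<subseteq> S"
    and D: "D \<subseteq> N - S" "\<And>v. v \<in> D \<Longrightarrow> pa v \<subseteq> F \<union> D" and F: "F \<subseteq> S"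
    and \<phi>: "\<phi> \<in> borel_measurable (PiM (F \<union> D) M)" and \<psi>: "\<psi> \<in> borel_measurable (PiM S M)"
  shows "(\<integral>\<^sup>+x. weight N x * (\<psi> (restrict x S) * \<phi> (restrict x (F \<union> D))) \<partial>PiM N M)
    = (\<integral>\<^sup>+x. weight N x * (\<psi> (restrict x S) * conditional F D \<phi> (restrict x F)) \<partial>PiM N M)"
proof -
  have DN: "D \<subseteq> N" and SD: "S \<union> D \<subseteq> N" "S \<inter> D = {}" and fin: "finite S" "finite D"
    using S D finite_sub[of S] finite_sub[of D] by auto
  have sub: "S \<subseteq> S \<union> D" "F \<union> D \<subseteq> S \<union> D" using F by auto
  have cm: "conditional F D \<phi> \<in> borel_measurable (PiM F M)"
    by (rule conditional_measurable[OF DN D(2) \<phi>])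
  have m1: "(\<lambda>x. \<psi> (restrict x S) * \<phi> (restrict x (F \<union> D))) \<in> borel_measurable (PiM (S \<union> D) M)"
    by (intro borel_measurable_times_ennreal measurable_compose[OF measurable_restrict_subset \<psi>]
        measurable_compose[OF measurable_restrict_subset \<phi>] sub)
  have m2: "(\<lambda>x. \<psi> x * conditional F D \<phi> (restrict x F)) \<in> borel_measurable (PiM S M)"
    by (intro borel_measurable_times_ennreal \<psi> measurable_compose[OF measurable_restrict_subset cm] F)
  have pSD: "pa v \<subseteq> S \<union> D" if "v \<in> S \<union> D" for v
    using that S(2) D(2) F by blast
  have wSD: "weight (S \<union> D) \<in> borel_measurable (PiM (S \<union> D) M)"
    using SD pSD by (intro weight_measurable) auto
  have wD: "weight D \<in> borel_measurable (PiM (F \<union> D) M)"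
    using DN D by (intro weight_measurable) auto
  have "(\<integral>\<^sup>+x. weight N x * (\<psi> (restrict x S) * \<phi> (restrict x (F \<union> D))) \<partial>PiM N M)
    = (\<integral>\<^sup>+x. weight (S \<union> D) x * (\<psi> (restrict x S) * \<phi> (restrict x (F \<union> D))) \<partial>PiM (S \<union> D) M)"
    using marginal_density[OF SD(1) pSD m1] by (simp add: Int_absorb1[OF sub(1)] Int_absorb1[OF sub(2)])
  also have "\<dots> = (\<integral>\<^sup>+y. (\<integral>\<^sup>+z. weight (S \<union> D) (merge S D (y, z)) * (\<psi> (restrict (merge S D (y, z)) S) *
      \<phi> (restrict (merge S D (y, z)) (F \<union> D))) \<partial>PiM D M) \<partial>PiM S M)"
    by (rule product_nn_integral_fold[OF SD(2) fin borel_measurable_times_ennreal[OF wSD m1]])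
  also have "\<dots> = (\<integral>\<^sup>+y. weight S y * (\<psi> y * conditional F D \<phi> (restrict y F)) \<partial>PiM S M)"
  proof (rule nn_integral_cong)
    fix y assume y: "y \<in> space (PiM S M)"
    have yF: "restrict y F \<in> space (PiM F M)"
      using y F by (auto simp: space_PiM)
    have "restrict (merge S D (y, z)) S = y" for z
      using y by (auto simp: fun_eq_iff merge_def space_PiM PiE_iff extensional_def)
    moreover have "weight S (merge S D (y, z)) = weight S y" for z
      using S(2) by (intro weight_cong) (auto simp: merge_def)
    moreover have "weight D (merge S D (y, z)) = weight D (merge F D (restrict y F, z))" for z
    proof (rule weight_cong)
      fix v i assume "v \<in> D" "i = v \<or> i \<in> pa v"
      then have "i \<in> F \<union> D" using D(2) by auto
      then show "merge S D (y, z) i = merge F D (restrict y F, z) i"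
        using F SD by (auto simp: merge_def)
    qed
    moreover have "restrict (merge S D (y, z)) (F \<union> D) = merge F D (restrict y F, z)" for z
      using F SD by (auto simp: fun_eq_iff merge_def restrict_def)
    moreover have "weight (S \<union> D) x = weight S x * weight D x" for x
      using SD S DN by (intro weight_union) auto
    ultimately have "(\<integral>\<^sup>+z. weight (S \<union> D) (merge S D (y, z)) * (\<psi> (restrict (merge S D (y, z)) S) *
        \<phi> (restrict (merge S D (y, z)) (F \<union> D))) \<partial>PiM D M)
      = (\<integral>\<^sup>+z. (weight S y * \<psi> y) * (weight D (merge F D (restrict y F, z)) * \<phi> (merge F D (restrict y F, z))) \<partial>PiM D M)"
      by (simp add: mult_ac)
    also have "\<dots> = weight S y * (\<psi> y * conditional F D \<phi> (restrict y F))"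
    proof -
      have "(\<lambda>z. weight D (merge F D (restrict y F, z)) * \<phi> (merge F D (restrict y F, z))) \<in> borel_measurable (PiM D M)"
        by (intro measurable_compose[OF _ borel_measurable_times_ennreal[OF wD \<phi>]]
            measurable_compose[OF measurable_Pair1'[OF yF] measurable_merge])
      then show ?thesis
        by (simp add: nn_integral_cmult conditional_def mult_ac)
    qed
    finally show "(\<integral>\<^sup>+z. weight (S \<union> D) (merge S D (y, z)) * (\<psi> (restrict (merge S D (y, z)) S) *
        \<phi> (restrict (merge S D (y, z)) (F \<union> D))) \<partial>PiM D M)
      = weight S y * (\<psi> y * conditional F D \<phi> (restrict y F))" .
  qed
  \<comment> \<open>\<open>marginal_density\<close> for \<open>S\<close>, read from right to left,
    restores the integral over all nodes.\<close>
  also have "\<dots> = (\<integral>\<^sup>+x. weight N x * (\<psi> (restrict x S) * conditional F D \<phi> (restrict x F)) \<partial>PiM N M)"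
    using marginal_density[OF S m2] F by (simp add: Int_absorb1 Int_absorb2)
  finally show ?thesis .
qed

text \<open>Needed to speak of conditional expectations given the coordinates in \<open>T\<close>:
  restriction is measurable, so it generates a sub-sigma-algebra, and the measure is finite.\<close>

lemma finite_measure_subalgebra_restrict:
  assumes "T \<subseteq> N"
  shows "finite_measure_subalgebra J (vimage_algebra (space J) (\<lambda>x. restrict x T) (PiM T M))"
proof -
  interpret prob_space J by (rule prob_space_J)
  show ?thesis
  proof
    have "(\<lambda>x. restrict x T) \<in> J \<rightarrow>\<^sub>M PiM T M"
      using measurable_restrict_subset[OF assms] by simp
    then show "subalgebra J (vimage_algebra (space J) (\<lambda>x. restrict x T) (PiM T M))"
      unfolding subalgebra_def by (auto intro: subsetD[OF sets_image_in_sets[OF sym]])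
  qed
qed

text \<open>The candidate on the left does not mention \<open>T\<close>, so one function serves all
  sigma-algebras between those of \<open>F\<close> and \<open>S\<close>. It is measurable because
  \<open>F \<subseteq> T\<close>, and the test sets are covered by
  \<open>nn_integral_conditional\<close> because \<open>T \<subseteq> S\<close>.\<close>

lemma nn_cond_exp_conditional:
  assumes S: "S \<subseteq> N" "\<And>v. v \<in> S \<Longrightarrow> pa v \<subseteq> S"
    and D: "D \<subseteq> N - S" "\<And>v. v \<in> D \<Longrightarrow> pa v \<subseteq> F \<union> D" and T: "F \<subseteq> T" "T \<subseteq> S"
    and \<phi>: "\<phi> \<in> borel_measurable (PiM (F \<union> D) M)"
  shows "AE x in J. conditional F D \<phi> (restrict x F) =
    nn_cond_exp J (vimage_algebra (space J) (\<lambda>x. restrict x T) (PiM T M))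
      (\<lambda>x. \<phi> (restrict x (F \<union> D))) x"
proof -
  have TN: "T \<subseteq> N" and FDN: "F \<union> D \<subseteq> N" and FN: "F \<subseteq> N" and DN: "D \<subseteq> N" using S D T by auto
  interpret finite_measure_subalgebra J "vimage_algebra (space J) (\<lambda>x. restrict x T) (PiM T M)"
    by (rule finite_measure_subalgebra_restrict[OF TN])
  have cm: "conditional F D \<phi> \<in> borel_measurable (PiM F M)"
    by (rule conditional_measurable[OF DN D(2) \<phi>])
  have mphi: "(\<lambda>x. \<phi> (restrict x (F \<union> D))) \<in> borel_measurable (PiM N M)"
    by (intro measurable_compose[OF measurable_restrict_subset \<phi>] FDN)
  have mc: "(\<lambda>x. conditional F D \<phi> (restrict x F)) \<in> borel_measurable (PiM N M)"
    by (intro measurable_compose[OF measurable_restrict_subset cm] FN)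
  show ?thesis
  proof (rule nn_cond_exp_charact)
    show "(\<lambda>x. \<phi> (restrict x (F \<union> D))) \<in> borel_measurable J"
      using mphi by simp
    show "(\<lambda>x. conditional F D \<phi> (restrict x F)) \<in>
        borel_measurable (vimage_algebra (space J) (\<lambda>x. restrict x T) (PiM T M))"
      using measurable_compose[OF measurable_restrict_vimage_algebra[OF T(1) TN] cm] by simp
    fix A assume A: "A \<in> sets (vimage_algebra (space J) (\<lambda>x. restrict x T) (PiM T M))"
    have "(\<lambda>x. restrict x T) \<in> space J \<rightarrow> space (PiM T M)"
      using TN by (auto simp: space_PiM PiE_iff)
    with A obtain B where B: "B \<in> sets (PiM T M)" and AB: "A = (\<lambda>x. restrict x T) -` B \<inter> space (PiM N M)"
      by (auto simp: sets_vimage_algebra2)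
    \<comment> \<open>The indicator of \<open>A\<close>, written as a function of the coordinates in
      \<open>S\<close>.\<close>
    define \<psi> where "\<psi> y = (indicator B (restrict y T) :: ennreal)" for y
    have \<psi>: "\<psi> \<in> borel_measurable (PiM S M)"
      unfolding \<psi>_def using B T by (intro measurable_compose[OF measurable_restrict_subset borel_measurable_indicator])
    have ind: "indicator A x = \<psi> (restrict x S)" if "x \<in> space (PiM N M)" for x
      using that T(2) by (auto simp: AB \<psi>_def indicator_def Int_absorb1)
    have "A \<in> sets (PiM N M)"
      using A subalg by (auto simp: subalgebra_def)
    then have mA: "(indicator A :: _ \<Rightarrow> ennreal) \<in> borel_measurable (PiM N M)"
      by simp
    have "(\<integral>\<^sup>+x\<in>A. g x \<partial>J) = (\<integral>\<^sup>+x. weight N x * (\<psi> (restrict x S) * g x) \<partial>PiM N M)"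
      if "g \<in> borel_measurable (PiM N M)" for g
    proof -
      have "(\<integral>\<^sup>+x\<in>A. g x \<partial>J) = (\<integral>\<^sup>+x. weight N x * (g x * indicator A x) \<partial>PiM N M)"
        using that mA by (intro nn_integral_density) auto
      also have "\<dots> = (\<integral>\<^sup>+x. weight N x * (\<psi> (restrict x S) * g x) \<partial>PiM N M)"
        by (intro nn_integral_cong) (simp add: ind mult_ac)
      finally show ?thesis .
    qed
    from this[OF mphi] this[OF mc] nn_integral_conditional[OF S D _ \<phi> \<psi>] T
    show "(\<integral>\<^sup>+x\<in>A. \<phi> (restrict x (F \<union> D)) \<partial>J) = (\<integral>\<^sup>+x\<in>A. conditional F D \<phi> (restrict x F) \<partial>J)"
      by simp
  qed
qed

text \<open>Taking \<open>T\<close> to be \<open>F\<close> and then \<open>S\<close> in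
  \<open>nn_cond_exp_conditional\<close> yields the same version both times. This is the Markov
  property that lets the frontier replace all of \<open>S\<close>.\<close>

lemma real_cond_exp_frontier:
  fixes c :: "('n \<Rightarrow> 'a) \<Rightarrow> real"
  assumes S: "S \<subseteq> N" "\<And>v. v \<in> S \<Longrightarrow> pa v \<subseteq> S"
    and D: "D \<subseteq> N - S" "\<And>v. v \<in> D \<Longrightarrow> pa v \<subseteq> F \<union> D" and F: "F \<subseteq> S"
    and c: "c \<in> borel_measurable (PiM Z M)" and Z: "Z \<subseteq> F \<union> D"
  shows "AE x in J. real_cond_exp J (vimage_algebra (space J) (\<lambda>x. restrict x F) (PiM F M)) (\<lambda>x. c (restrict x Z)) x
    = real_cond_exp J (vimage_algebra (space J) (\<lambda>x. restrict x S) (PiM S M)) (\<lambda>x. c (restrict x Z)) x"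
proof -
  have m: "(\<lambda>x. c (restrict x Z)) \<in> borel_measurable (PiM (F \<union> D) M)"
    by (intro measurable_compose[OF measurable_restrict_subset c] Z)
  \<comment> \<open>Positive and negative part of the cost, as \<open>ennreal\<close> sends negative
    numbers to 0; \<open>real_cond_exp\<close> is the difference of their nonnegative conditional
    expectations.\<close>
  define c1 c2 where "c1 x = ennreal (c (restrict x Z))" and "c2 x = ennreal (- c (restrict x Z))" for x
  have m12: "c1 \<in> borel_measurable (PiM (F \<union> D) M)" "c2 \<in> borel_measurable (PiM (F \<union> D) M)"
    unfolding c1_def c2_def using m by measurable
  have r: "c1 (restrict x (F \<union> D)) = c1 x" "c2 (restrict x (F \<union> D)) = c2 x" for x
    using Z by (simp_all add: c1_def c2_def Int_absorb1)
  have "AE x in J. nn_cond_exp J (vimage_algebra (space J) (\<lambda>x. restrict x F) (PiM F M)) c x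
    = nn_cond_exp J (vimage_algebra (space J) (\<lambda>x. restrict x S) (PiM S M)) c x"
    if "c \<in> borel_measurable (PiM (F \<union> D) M)" "\<And>x. c (restrict x (F \<union> D)) = c x" for c
  proof -
    note AE = nn_cond_exp_conditional[where S = S and D = D and F = F, OF S D _ _ that(1), unfolded that(2)]
    show ?thesis
      using AE[of F] AE[of S] F by (auto elim!: eventually_elim2)
  qed
  from this[OF m12(1) r(1)] this[OF m12(2) r(2)] show ?thesis
    by eventually_elim (simp add: real_cond_exp_def c1_def[abs_def] c2_def[abs_def])
qed

end

section \<open>Gradients: representation, logarithms and measurability\<close>

lemma gradient_eq:
  assumes "GDERIV g t :> D"
  shows "gradient g t = D"
  unfolding gradient_def
proof (rule the_equality)
  show "GDERIV g t :> D" by fact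
  fix D' assume "GDERIV g t :> D'"
  then have "(\<lambda>h. h \<bullet> D') = (\<lambda>h. h \<bullet> D)"
    using assms unfolding gderiv_def by (rule has_derivative_unique)
  then show "D' = D"
    by (metis vector_eq_ldot)
qed

text \<open>The derivative is a linear functional on a Euclidean space, and its adjoint applied to 1
  is the vector that represents it through the inner product.\<close>

lemma GDERIV_gradient:
  fixes g :: "'p::euclidean_space \<Rightarrow> real"
  assumes "g differentiable (at t)"
  shows "GDERIV g t :> gradient g t"
proof -
  from assms obtain g' where g': "(g has_derivative g') (at t)"
    by (auto simp: differentiable_def)
  then have "g' = (\<lambda>h. h \<bullet> adjoint g' 1)"
    by (simp add: fun_eq_iff adjoint_works has_derivative_linear)
  then have "GDERIV g t :> adjoint g' 1"
    using g' unfolding gderiv_def by metis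
  then show ?thesis
    using gradient_eq by metis
qed

lemma gradient_cmult:
  assumes "GDERIV g t :> D"
  shows "gradient (\<lambda>t. c * g t) t = c *\<^sub>R D"
  using GDERIV_mult[OF GDERIV_const assms, of c] by (intro gradient_eq) simp

lemma gradient_ln:
  assumes "GDERIV g t :> D" "0 < g t"
  shows "gradient (\<lambda>t. ln (g t)) t = (1 / g t) *\<^sub>R D"
proof -
  have "DERIV ln (g t) :> 1 / g t"
    using assms(2) by (rule DERIV_ln_divide)
  from GDERIV_DERIV_compose[OF assms(1) this] show ?thesis
    by (rule gradient_eq)
qed

text \<open>The chain rule along the line through \<open>t\<close> in direction \<open>b\<close>.
  The steps \<open>1 / (n + 1)\<close> make this the limit of a sequence, which is the form that
  preserves measurability.\<close>

lemma GDERIV_difference_quotient: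
  assumes "GDERIV g t :> D"
  shows "(\<lambda>n. (g (t + inverse (real (Suc n)) *\<^sub>R b) - g t) / inverse (real (Suc n))) \<longlonglongrightarrow> D \<bullet> b"
proof -
  have "((\<lambda>s. t + s *\<^sub>R b) has_derivative (\<lambda>s. s *\<^sub>R b)) (at 0)"
    by (auto intro!: derivative_eq_intros)
  moreover have "(g has_derivative (\<lambda>h. h \<bullet> D)) (at (t + 0 *\<^sub>R b))"
    using assms by (simp add: gderiv_def)
  ultimately have "((\<lambda>s. g (t + s *\<^sub>R b)) has_derivative (\<lambda>s. (s *\<^sub>R b) \<bullet> D)) (at 0)"
    by (rule has_derivative_compose)
  then have "((\<lambda>s. g (t + s *\<^sub>R b)) has_field_derivative D \<bullet> b) (at 0)"
    unfolding has_field_derivative_def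
    by (rule has_derivative_eq_rhs) (simp add: fun_eq_iff inner_commute[of b D])
  then have "((\<lambda>s. (g (t + s *\<^sub>R b) - g t) / s) \<longlongrightarrow> D \<bullet> b) (at 0)"
    by (simp add: DERIV_def)
  moreover have "filterlim (\<lambda>n. inverse (real (Suc n))) (at 0) sequentially"
    using LIMSEQ_inverse_real_of_nat by (intro filterlim_atI) auto
  ultimately show ?thesis
    by (rule filterlim_compose)
qed

text \<open>Each coordinate of the gradient is a pointwise limit of difference quotients with fixed
  steps, and these are measurable in \<open>x\<close>.\<close>

lemma borel_measurable_gradient:
  fixes p :: "'p::euclidean_space \<Rightarrow> 'b \<Rightarrow> real"
  assumes "open P" "t \<in> P" and p: "\<And>u. u \<in> P \<Longrightarrow> p u \<in> borel_measurable K"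
    and diff: "\<And>x. x \<in> space K \<Longrightarrow> (\<lambda>u. p u x) differentiable (at t)"
  shows "(\<lambda>x. gradient (\<lambda>u. p u x) t) \<in> borel_measurable K"
proof (rule borel_measurable_euclidean_space[THEN iffD2], rule ballI)
  fix b :: 'p assume "b \<in> Basis"
  \<comment> \<open>Measurability of \<open>p u\<close> is given for \<open>u\<close> in
    \<open>P\<close>. As \<open>P\<close> is open, the shifted parameters lie in it from some index
    \<open>m\<close> on, and the earlier terms are dropped.\<close>
  have "(\<lambda>n. t + inverse (real (Suc n)) *\<^sub>R b) \<longlonglongrightarrow> t + 0 *\<^sub>R b"
    by (intro tendsto_intros LIMSEQ_inverse_real_of_nat)
  then have "eventually (\<lambda>n. t + inverse (real (Suc n)) *\<^sub>R b \<in> P) sequentially"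
    using assms(1,2) by (auto simp: tendsto_def)
  then obtain m where "\<forall>n\<ge>m. t + inverse (real (Suc n)) *\<^sub>R b \<in> P"
    unfolding eventually_sequentially by blast
  then have m: "t + inverse (real (Suc (n + m))) *\<^sub>R b \<in> P" for n
    using le_add2 by blast
  show "(\<lambda>x. gradient (\<lambda>u. p u x) t \<bullet> b) \<in> borel_measurable K"
  proof (rule borel_measurable_LIMSEQ_real)
    fix x assume "x \<in> space K"
    from GDERIV_difference_quotient[OF GDERIV_gradient[OF diff[OF this]]]
    show "(\<lambda>n. (p (t + inverse (real (Suc (n + m))) *\<^sub>R b) x - p t x) / inverse (real (Suc (n + m))))
        \<longlonglongrightarrow> gradient (\<lambda>u. p u x) t \<bullet> b"
      by (rule LIMSEQ_ignore_initial_segment)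
  next
    fix n
    show "(\<lambda>x. (p (t + inverse (real (Suc (n + m))) *\<^sub>R b) x - p t x) / inverse (real (Suc (n + m))))
        \<in> borel_measurable K"
      using p[OF m[of n]] p[OF assms(2)] by measurable
  qed
qed

lemma integrable_componentwise:
  fixes f :: "'b \<Rightarrow> 'p::euclidean_space"
  assumes "\<And>b. b \<in> Basis \<Longrightarrow> integrable K (\<lambda>x. f x \<bullet> b)"
  shows "integrable K f"
proof -
  have "integrable K (\<lambda>x. \<Sum>b\<in>Basis. (f x \<bullet> b) *\<^sub>R b)"
    using assms by (intro Bochner_Integration.integrable_sum integrable_scaleR_left) auto
  then show ?thesis
    by (simp add: euclidean_representation)
qed

section \<open>Stochastic computation graphs as Bayesian networks\<close>

locale valid_stoch_graph =
  fixes G :: "('n, 'a, 'p::euclidean_space) stoch_graph" and \<theta> :: "'n \<Rightarrow> 'p"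
  assumes graph: "stoch_comp_graph G" and valid: "valid_params G \<theta>"
begin

text \<open>Product measures are only available for families that are sigma-finite at every index, hence the
  dummy value outside the graph.\<close>

definition ref :: "'n \<Rightarrow> 'a measure" where
  "ref v = (if v \<in> nodes G then base G v else count_space {})"

lemma PiM_ref: "T \<subseteq> nodes G \<Longrightarrow> PiM T ref = PiM T (base G)"
  by (intro PiM_cong) (auto simp: ref_def)

lemma parents_sub: "parents G v \<subseteq> nodes G"
  using graph by (auto simp: stoch_comp_graph_def parents_def)

sublocale bayes_net ref "nodes G" "edges G" "parents G"
  "\<lambda>v y x. ennreal (cond_density G v (\<theta> v) y x)"
proof (intro bayes_net.intro product_sigma_finite.intro bayes_net_axioms.intro, goal_cases)
  \<comment> \<open>Goal 1 is sigma-finiteness at every index, goals 5 to 7 are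
    \<open>pa_def\<close>, \<open>k_meas\<close> and \<open>k_one\<close>; the others are the
    conditions on the graph.\<close>
  case (1 v)
  then show ?case
    using graph by (auto simp: ref_def stoch_comp_graph_def intro!: sigma_finite_measure_count_space_finite)
next
  case (5 v)
  then show ?case by (rule parents_def)
next
  case (6 v)
  then have "(\<lambda>(y, x). cond_density G v (\<theta> v) y x)
      \<in> borel_measurable (PiM (parents G v) (base G) \<Otimes>\<^sub>M base G v)"
    using graph valid by (auto simp: stoch_comp_graph_def valid_params_def)
  from measurable_compose[OF this measurable_ennreal] 6 show ?case
    by (simp add: PiM_ref[OF parents_sub] ref_def case_prod_unfold)
next
  case (7 v y)
  then show ?case
    using graph valid by (simp add: stoch_comp_graph_def valid_params_def PiM_ref[OF parents_sub] ref_def)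
qed (use graph in \<open>auto simp: stoch_comp_graph_def\<close>)

lemma cond_density_measurable:
  assumes "v \<in> nodes G" "t \<in> params G v" "v \<in> T" "parents G v \<subseteq> T"
  shows "(\<lambda>x. cond_density G v t (restrict x (parents G v)) (x v)) \<in> borel_measurable (PiM T (base G))"
proof -
  have *: "(\<lambda>(y, x). cond_density G v t y x) \<in> borel_measurable (PiM (parents G v) (base G) \<Otimes>\<^sub>M base G v)"
    using graph assms by (auto simp: stoch_comp_graph_def)
  have "(\<lambda>x. (restrict x (parents G v), x v)) \<in> PiM T (base G) \<rightarrow>\<^sub>M PiM (parents G v) (base G) \<Otimes>\<^sub>M base G v"
    using assms by (intro measurable_Pair measurable_restrict_subset measurable_component_singleton)
  from measurable_compose[OF this *] show ?thesis by simp
qed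

lemma restrict_in_space:
  "x \<in> space (PiM S (base G)) \<Longrightarrow> T \<subseteq> S \<Longrightarrow> restrict x T \<in> space (PiM T (base G))"
  by (auto simp: space_PiM PiE_iff)

lemma cond_density_nonneg:
  assumes "v \<in> nodes G" "x \<in> space (PiM (nodes G) (base G))"
  shows "0 \<le> cond_density G v (\<theta> v) (restrict x (parents G v)) (x v)"
proof -
  have "\<theta> v \<in> params G v" "restrict x (parents G v) \<in> space (PiM (parents G v) (base G))"
      "x v \<in> space (base G v)"
    using assms valid restrict_in_space[OF assms(2) parents_sub]
    by (auto simp: valid_params_def space_PiM PiE_iff)
  then show ?thesis
    using graph assms(1) by (auto simp: stoch_comp_graph_def)
qed

lemma joint_density_nonneg: "x \<in> space (PiM (nodes G) (base G)) \<Longrightarrow> 0 \<le> joint_density G \<theta> x"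
  unfolding joint_density_def by (intro prod_nonneg ballI cond_density_nonneg)

lemma joint_density_measurable: "joint_density G \<theta> \<in> borel_measurable (PiM (nodes G) (base G))"
  unfolding joint_density_def[abs_def] using valid parents_sub
  by (intro borel_measurable_prod cond_density_measurable) (auto simp: valid_params_def)

text \<open>On the product space all factors are nonnegative, so \<open>ennreal\<close> commutes
  with the product; agreement there is enough for equality of the measures.\<close>

lemma joint_eq: "joint G \<theta> = J"
proof -
  have "ennreal (joint_density G \<theta> x) = weight (nodes G) x" if "x \<in> space (PiM (nodes G) (base G))" for x
    using cond_density_nonneg[OF _ that] by (simp add: joint_density_def weight_def prod_ennreal)
  then show ?thesis
    unfolding joint_def PiM_ref[OF order_refl]
    using joint_density_measurable weight_N_measurable
    by (intro density_cong) (auto simp: PiM_ref[OF order_refl])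
qed

lemma total_cost_measurable: "total_cost G \<in> borel_measurable (PiM (nodes G) (base G))"
  unfolding total_cost_def[abs_def]
  using graph by (intro measurable_compose[OF measurable_restrict_subset]) (auto simp: stoch_comp_graph_def)

lemma space_joint: "space (joint G \<theta>) = space (PiM (nodes G) (base G))"
  by (simp add: joint_def)

lemma sets_joint: "sets (joint G \<theta>) = sets (PiM (nodes G) (base G))"
  by (simp add: joint_def)

lemma integral_joint:
  fixes f :: "_ \<Rightarrow> 'b::euclidean_space"
  assumes "f \<in> borel_measurable (PiM (nodes G) (base G))"
  shows "(\<integral>x. f x \<partial>joint G \<theta>) = (\<integral>x. joint_density G \<theta> x *\<^sub>R f x \<partial>PiM (nodes G) (base G))"
  unfolding joint_def
  by (intro integral_density assms joint_density_measurable AE_I2 joint_density_nonneg)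

lemma integrable_joint:
  fixes f :: "_ \<Rightarrow> 'b::euclidean_space"
  assumes "f \<in> borel_measurable (PiM (nodes G) (base G))"
  shows "integrable (joint G \<theta>) f \<longleftrightarrow>
    integrable (PiM (nodes G) (base G)) (\<lambda>x. joint_density G \<theta> x *\<^sub>R f x)"
  unfolding joint_def
  by (intro integrable_density assms joint_density_measurable AE_I2 joint_density_nonneg)

text \<open>Brings the expected cost into the form in which differentiation under the integral is
  assumed.\<close>

lemma expected_cost_eq:
  "expected_cost G \<theta> = (\<integral>x. total_cost G x * joint_density G \<theta> x \<partial>PiM (nodes G) (base G))"
  unfolding expected_cost_def integral_joint[OF total_cost_measurable] by (simp add: mult.commute)

lemma ancestors_sub: "v \<in> nodes G \<Longrightarrow> ancestors G v \<union> {v} \<subseteq> nodes G"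
  using graph trancl_subset_Sigma[of "edges G" "nodes G"]
  by (auto simp: stoch_comp_graph_def ancestors_def)

lemma parents_ancestors: "u \<in> ancestors G v \<union> {v} \<Longrightarrow> parents G u \<subseteq> ancestors G v"
  by (auto simp: parents_def ancestors_def intro: trancl_into_trancl2)

text \<open>A parent of a node in \<open>D\<close> reaches the cost through that node, so it is in
  the frontier if it belongs to \<open>S\<close> and in \<open>D\<close> otherwise. The arguments of
  the cost are divided in the same way, which gives the hypotheses of
  \<open>real_cond_exp_frontier\<close>.\<close>

lemma real_cond_exp_cost_frontier:
  assumes S: "S \<subseteq> nodes G" "\<And>v. v \<in> S \<Longrightarrow> parents G v \<subseteq> S"
  defines "F \<equiv> cost_frontier G S"
  shows "AE x in joint G \<theta>.
    real_cond_exp (joint G \<theta>) (vimage_algebra (space (joint G \<theta>)) (\<lambda>x. restrict x F) (PiM F (base G)))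
      (total_cost G) x =
    real_cond_exp (joint G \<theta>) (vimage_algebra (space (joint G \<theta>)) (\<lambda>x. restrict x S) (PiM S (base G)))
      (total_cost G) x"
proof -
  \<comment> \<open>The frontier condition without membership in \<open>S\<close>: it cuts out the
    frontier inside \<open>S\<close> and \<open>D\<close> outside.\<close>
  define reach where "reach v \<longleftrightarrow> (\<exists>us. set us \<subseteq> Some ` (nodes G - S) \<and>
    successively (\<lambda>a b. (a, b) \<in> cost_edges G) (Some v # us @ [None]))" for v
  define D where "D = {v \<in> nodes G - S. reach v}"
  have F: "F = {v \<in> S. reach v}"
    by (simp add: F_def cost_frontier_def reach_def)
  have Z: "cost_args G \<subseteq> nodes G"
    using graph by (simp add: stoch_comp_graph_def)
  have "reach z" if "z \<in> cost_args G" for z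
    unfolding reach_def using that by (intro exI[of _ "[]"]) (auto simp: cost_edges_def)
  then have ZFD: "cost_args G \<subseteq> F \<union> D"
    using Z by (auto simp: F D_def)
  have "reach u" if "v \<in> D" "u \<in> parents G v" for u v
  proof -
    from that(1) obtain us where v: "v \<in> nodes G - S" and us: "set us \<subseteq> Some ` (nodes G - S)"
      "successively (\<lambda>a b. (a, b) \<in> cost_edges G) (Some v # us @ [None])"
      by (auto simp: D_def reach_def)
    moreover have "(Some u, Some v) \<in> cost_edges G"
      using that(2) by (auto simp: cost_edges_def parents_def)
    \<comment> \<open>The path from \<open>v\<close> is extended at the front; \<open>v\<close> may
      be an intermediate node because it lies outside \<open>S\<close>.\<close>
    ultimately show ?thesis
      unfolding reach_def by (intro exI[of _ "Some v # us"]) auto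
  qed
  then have paD: "parents G v \<subseteq> F \<union> D" if "v \<in> D" for v
    using that parents_sub[of v] by (auto simp: F D_def)
  have c: "cost G \<in> borel_measurable (PiM (cost_args G) ref)"
    using graph by (simp add: stoch_comp_graph_def PiM_ref[OF Z])
  have "D \<subseteq> nodes G - S" "F \<subseteq> S" by (auto simp: D_def F)
  then have FN: "F \<subseteq> nodes G" using S(1) by auto
  show ?thesis
    using real_cond_exp_frontier[OF S \<open>D \<subseteq> nodes G - S\<close> paD \<open>F \<subseteq> S\<close> c ZFD]
    unfolding joint_eq total_cost_def[abs_def] PiM_ref[OF FN] PiM_ref[OF S(1)] .
qed

end

section \<open>The score-function formula for the gradient of the expected cost\<close>

theorem theorem1:
  fixes G :: "('n, 'a, 'p::euclidean_space) stoch_graph"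
    and \<theta> :: "'n \<Rightarrow> 'p" and X :: 'n and Q :: "('n \<Rightarrow> 'a) \<Rightarrow> real"
  assumes "stoch_comp_graph G"
    and "valid_params G \<theta>"
    and "X \<in> nodes G"
    and positive: "\<And>y x. y \<in> space (PiM (parents G X) (base G)) \<Longrightarrow> x \<in> space (base G X) \<Longrightarrow>
           0 < cond_density G X (\<theta> X) y x"
    and differentiable: "\<And>y x. y \<in> space (PiM (parents G X) (base G)) \<Longrightarrow> x \<in> space (base G X) \<Longrightarrow>
           (\<lambda>t. cond_density G X t y x) differentiable (at (\<theta> X))"
    and cost_integrable: "\<And>t. t \<in> params G X \<Longrightarrow>
           integrable (joint G (\<theta>(X := t))) (total_cost G)"
    and interchange_integrable: "integrable (PiM (nodes G) (base G))
           (\<lambda>x. gradient (\<lambda>t. total_cost G x * joint_density G (\<theta>(X := t)) x) (\<theta> X))"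
    and interchange:
      "GDERIV (\<lambda>t. \<integral>x. total_cost G x * joint_density G (\<theta>(X := t)) x \<partial>PiM (nodes G) (base G)) (\<theta> X) :>
         (\<integral>x. gradient (\<lambda>t. total_cost G x * joint_density G (\<theta>(X := t)) x) (\<theta> X)
            \<partial>PiM (nodes G) (base G))"
    and "is_Q_function G \<theta> X Q"
  shows "GDERIV (\<lambda>t. expected_cost G (\<theta>(X := t))) (\<theta> X) :>
           (\<integral>y. Q (restrict y (cost_frontier G (ancestors G X \<union> {X}))) *\<^sub>R
                 gradient (\<lambda>t. ln (cond_density G X t (restrict y (parents G X)) (y X))) (\<theta> X)
              \<partial>marginal G \<theta> (ancestors G X \<union> {X}))"
proof -
  interpret valid_stoch_graph G \<theta>
    using assms(1,2) by unfold_locales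
  define S where "S = ancestors G X \<union> {X}"
  define F where "F = cost_frontier G S"
  define N where "N = nodes G"
  define c where "c = total_cost G"
  \<comment> \<open>Both \<open>p t\<close> and the score \<open>s\<close> read coordinates in
    \<open>S\<close> only, so they apply to assignments on \<open>S\<close> and on all nodes
    alike.\<close>
  define p where "p t x = cond_density G X t (restrict x (parents G X)) (x X)" for t x
  define s where "s x = gradient (\<lambda>t. ln (p t x)) (\<theta> X)" for x
  let ?J = "joint G \<theta>" and ?P = "\<lambda>T. PiM T (base G)"
  let ?\<sigma> = "\<lambda>T. vimage_algebra (space ?J) (\<lambda>x. restrict x T) (?P T)"
  have SN: "S \<subseteq> N"
    using ancestors_sub[OF \<open>X \<in> nodes G\<close>] by (simp add: S_def N_def)
  have paS: "\<And>v. v \<in> S \<Longrightarrow> parents G v \<subseteq> S"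
    using parents_ancestors by (auto simp: S_def)
  have XS: "X \<in> S" "parents G X \<subseteq> S"
    using paS by (auto simp: S_def)
  have FS: "F \<subseteq> S"
    by (auto simp: F_def cost_frontier_def)
  have \<theta>X: "\<theta> X \<in> params G X" and params: "open (params G X)"
    using assms(1-3) by (auto simp: valid_params_def stoch_comp_graph_def)
  have pos: "0 < p (\<theta> X) x" and diff: "(\<lambda>t. p t x) differentiable (at (\<theta> X))"
    if "x \<in> space (?P T)" "S \<subseteq> T" for x T
  proof -
    have "restrict x (parents G X) \<in> space (?P (parents G X))" "x X \<in> space (base G X)"
      using restrict_in_space[OF that(1)] XS that by (auto simp: space_PiM PiE_iff)
    then show "0 < p (\<theta> X) x" "(\<lambda>t. p t x) differentiable (at (\<theta> X))"
      unfolding p_def by (rule positive, rule differentiable)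
  qed
  note gderiv = GDERIV_gradient[OF diff]
  have s_eq: "s x = (1 / p (\<theta> X) x) *\<^sub>R gradient (\<lambda>t. p t x) (\<theta> X)"
    if "x \<in> space (?P T)" "S \<subseteq> T" for x T
    unfolding s_def by (rule gradient_ln[OF gderiv[OF that] pos[OF that]])
  have s_restrict: "s (restrict x S) = s x" for x
    using XS by (simp add: s_def p_def Int_absorb1)

  \<comment> \<open>The parameter of \<open>X\<close> occurs in a single factor of the joint
    density; the product \<open>R\<close> of the others is constant in \<open>t\<close>, and
    positivity turns the gradient of \<open>p\<close> into \<open>p\<close> times the score.\<close>
  have gradient_joint: "gradient (\<lambda>t. c x * joint_density G (\<theta>(X := t)) x) (\<theta> X)
      = joint_density G \<theta> x *\<^sub>R c x *\<^sub>R s x" if x: "x \<in> space (?P N)" for x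
  proof -
    define R where "R = (\<Prod>v\<in>N - {X}. cond_density G v (\<theta> v) (restrict x (parents G v)) (x v))"
    have "finite N" "X \<in> N"
      using finite_N assms(3) by (simp_all add: N_def)
    then have jd: "joint_density G (\<theta>(X := t)) x = p t x * R" for t
      unfolding joint_density_def N_def[symmetric] R_def
      by (subst prod.remove[of N X]) (auto simp: p_def intro!: prod.cong)
    have "gradient (\<lambda>t. c x * joint_density G (\<theta>(X := t)) x) (\<theta> X)
        = gradient (\<lambda>t. (c x * R) * p t x) (\<theta> X)"
      by (simp add: jd mult_ac)
    also have "\<dots> = (c x * R) *\<^sub>R gradient (\<lambda>t. p t x) (\<theta> X)"
      by (rule gradient_cmult[OF gderiv[OF x SN]])
    also have "\<dots> = joint_density G \<theta> x *\<^sub>R c x *\<^sub>R s x"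
      using jd[of "\<theta> X"] pos[OF x SN] by (simp add: s_eq[OF x SN] mult_ac)
    finally show ?thesis .
  qed

  \<comment> \<open>Difference quotients give measurability of the gradient of \<open>p\<close>;
    dividing by \<open>p\<close> then gives that of the score.\<close>
  have s_S: "s \<in> borel_measurable (?P S)"
  proof -
    have p: "p t \<in> borel_measurable (?P S)" if "t \<in> params G X" for t
      unfolding p_def[abs_def] using that XS assms(3) by (intro cond_density_measurable)
    have "(\<lambda>x. gradient (\<lambda>t. p t x) (\<theta> X)) \<in> borel_measurable (?P S)"
      using diff p by (intro borel_measurable_gradient[OF params \<theta>X]) auto
    then have "(\<lambda>x. (1 / p (\<theta> X) x) *\<^sub>R gradient (\<lambda>t. p t x) (\<theta> X)) \<in> borel_measurable (?P S)"
      using p[OF \<theta>X] by measurable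
    then show ?thesis
      by (simp add: s_eq cong: measurable_cong)
  qed
  have restrict_S: "(\<lambda>x. restrict x S) \<in> ?P N \<rightarrow>\<^sub>M ?P S"
    by (rule measurable_restrict_subset[OF SN])
  have s_N: "s \<in> borel_measurable (?P N)"
    using measurable_compose[OF restrict_S s_S] by (simp add: s_restrict)
  have c_N: "c \<in> borel_measurable (?P N)"
    unfolding c_def N_def by (rule total_cost_measurable)
  have cs_N: "(\<lambda>x. c x *\<^sub>R s x) \<in> borel_measurable (?P N)"
    using c_N s_N by measurable

  have cs_int: "integrable ?J (\<lambda>x. c x *\<^sub>R s x)"
  proof -
    have "integrable (?P N) (\<lambda>x. gradient (\<lambda>t. c x * joint_density G (\<theta>(X := t)) x) (\<theta> X)) \<longleftrightarrow>
        integrable (?P N) (\<lambda>x. joint_density G \<theta> x *\<^sub>R c x *\<^sub>R s x)"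
      by (intro Bochner_Integration.integrable_cong refl gradient_joint)
    then show ?thesis
      using interchange_integrable integrable_joint[OF cs_N[unfolded N_def]] by (simp only: c_def N_def)
  qed
  have "(\<integral>x. gradient (\<lambda>t. c x * joint_density G (\<theta>(X := t)) x) (\<theta> X) \<partial>?P N)
      = (\<integral>x. c x *\<^sub>R s x \<partial>?J)"
  proof -
    have "(\<integral>x. gradient (\<lambda>t. c x * joint_density G (\<theta>(X := t)) x) (\<theta> X) \<partial>?P N)
        = (\<integral>x. joint_density G \<theta> x *\<^sub>R c x *\<^sub>R s x \<partial>?P N)"
      by (intro Bochner_Integration.integral_cong refl gradient_joint)
    then show ?thesis
      using integral_joint[OF cs_N[unfolded N_def]] by (simp only: N_def)
  qed
  then have deriv: "GDERIV (\<lambda>t. \<integral>x. c x * joint_density G (\<theta>(X := t)) x \<partial>?P N) (\<theta> X) :> (\<integral>x. c x *\<^sub>R s x \<partial>?J)"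
    using interchange by (simp add: c_def N_def)

  have Q_F: "Q \<in> borel_measurable (?P F)"
    and "AE x in ?J. Q (restrict x F) = real_cond_exp ?J (?\<sigma> F) c x"
    using assms(9) by (simp_all add: is_Q_function_def Let_def S_def F_def c_def)
  \<comment> \<open>\<open>Q\<close> is given as a version for the frontier; from here on it is used
    as a version for all of \<open>S\<close>.\<close>
  with real_cond_exp_cost_frontier[OF SN[unfolded N_def] paS]
  have Q: "AE x in ?J. Q (restrict x F) = real_cond_exp ?J (?\<sigma> S) c x"
    unfolding F_def c_def by (auto elim!: eventually_elim2)
  have Qs_S: "(\<lambda>y. Q (restrict y F) *\<^sub>R s y) \<in> borel_measurable (?P S)"
    using measurable_compose[OF measurable_restrict_subset[OF FS] Q_F] s_S by measurable
  have Qs_J: "(\<lambda>x. Q (restrict x F) *\<^sub>R s x) \<in> borel_measurable ?J"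
    using measurable_compose[OF restrict_S Qs_S] FS
    by (simp add: s_restrict Int_absorb1 measurable_cong_sets[OF sets_joint refl] N_def)
  interpret finite_measure_subalgebra ?J "?\<sigma> S"
    using finite_measure_subalgebra_restrict SN
    by (simp add: joint_eq PiM_ref N_def)
  \<comment> \<open>\<open>real_cond_exp\<close> concerns real functions, so the score is paired
    with a vector \<open>b\<close>. Each \<open>s x \<bullet> b\<close> is measurable for the
    sigma-algebra of \<open>S\<close> and can be moved inside the conditional expectation;
    \<open>real_cond_exp_intg\<close> gives integrability as well as equal integrals.\<close>
  have component: "integrable ?J (\<lambda>x. (Q (restrict x F) *\<^sub>R s x) \<bullet> b)"
    "(\<integral>x. (Q (restrict x F) *\<^sub>R s x) \<bullet> b \<partial>?J) = (\<integral>x. (c x *\<^sub>R s x) \<bullet> b \<partial>?J)" for b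
  proof -
    have "s \<in> borel_measurable (?\<sigma> S)"
      using measurable_compose[OF measurable_restrict_vimage_algebra[OF order_refl SN] s_S]
      by (simp add: s_restrict space_joint N_def)
    then have sb: "(\<lambda>x. s x \<bullet> b) \<in> borel_measurable (?\<sigma> S)"
      by measurable
    have cJ: "c \<in> borel_measurable ?J"
      using c_N by (simp add: N_def measurable_cong_sets[OF sets_joint refl])
    have "integrable ?J (\<lambda>x. (c x *\<^sub>R s x) \<bullet> b)"
      using cs_int by (rule integrable_inner_left)
    then have int: "integrable ?J (\<lambda>x. (s x \<bullet> b) * c x)"
      by (simp add: mult.commute)
    note E = real_cond_exp_intg[OF int sb cJ]
    have AE: "AE x in ?J. (Q (restrict x F) *\<^sub>R s x) \<bullet> b = (s x \<bullet> b) * real_cond_exp ?J (?\<sigma> S) c x"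
      using Q by eventually_elim simp
    have m: "(\<lambda>x. (Q (restrict x F) *\<^sub>R s x) \<bullet> b) \<in> borel_measurable ?J"
      using Qs_J by measurable
    note mE = borel_measurable_integrable[OF E(1)]
    show "integrable ?J (\<lambda>x. (Q (restrict x F) *\<^sub>R s x) \<bullet> b)"
      using integrable_cong_AE[OF m mE AE] E(1) by simp
    show "(\<integral>x. (Q (restrict x F) *\<^sub>R s x) \<bullet> b \<partial>?J) = (\<integral>x. (c x *\<^sub>R s x) \<bullet> b \<partial>?J)"
      using integral_cong_AE[OF m mE AE] E(2) by (simp add: mult.commute)
  qed
  have Qs_int: "integrable ?J (\<lambda>x. Q (restrict x F) *\<^sub>R s x)"
    by (rule integrable_componentwise, rule component(1))
  have "(\<integral>x. c x *\<^sub>R s x \<partial>?J) = (\<integral>x. Q (restrict x F) *\<^sub>R s x \<partial>?J)"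
  proof (rule euclidean_eqI)
    fix b :: 'p
    show "(\<integral>x. c x *\<^sub>R s x \<partial>?J) \<bullet> b = (\<integral>x. Q (restrict x F) *\<^sub>R s x \<partial>?J) \<bullet> b"
      using component(2)[of b]
      by (simp only: integral_inner_left[OF cs_int, symmetric] integral_inner_left[OF Qs_int, symmetric])
  qed
  \<comment> \<open>The integrand reads coordinates in \<open>S\<close> only, so the integral can be
    taken over the image measure under restriction to \<open>S\<close>.\<close>
  also have "\<dots> = (\<integral>y. Q (restrict y F) *\<^sub>R s y \<partial>marginal G \<theta> S)"
    unfolding marginal_def
    using restrict_S FS
    by (subst integral_distr[OF _ Qs_S])
      (simp_all add: s_restrict Int_absorb1 measurable_cong_sets[OF sets_joint refl] N_def)
  finally have grad_eq: "(\<integral>x. c x *\<^sub>R s x \<partial>?J) = (\<integral>y. Q (restrict y F) *\<^sub>R s y \<partial>marginal G \<theta> S)" .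

  have cost: "(\<integral>x. c x * joint_density G (\<theta>(X := t)) x \<partial>?P N) = expected_cost G (\<theta>(X := t))"
    if "t \<in> params G X" for t
  proof -
    have "valid_params G (\<theta>(X := t))"
      using assms(2) that by (simp add: valid_params_def)
    then have "valid_stoch_graph G (\<theta>(X := t))"
      using assms(1) by unfold_locales
    from valid_stoch_graph.expected_cost_eq[OF this] show ?thesis
      by (simp add: c_def N_def)
  qed
  \<comment> \<open>The two functions of \<open>t\<close> are known to agree on
    \<open>params G X\<close>, an open set containing \<open>\<theta> X\<close>, which suffices for
    the derivative there.\<close>
  have "GDERIV (\<lambda>t. expected_cost G (\<theta>(X := t))) (\<theta> X) :> (\<integral>x. c x *\<^sub>R s x \<partial>?J)"
    using deriv unfolding gderiv_def
    by (rule has_derivative_transform_within_open[OF _ params \<theta>X cost])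
  then show ?thesis
    unfolding grad_eq unfolding S_def F_def s_def p_def .
qed

end
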